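(* Let $a, f \in C(\mathbb{R})$ be real-valued functions such that $|f(t)| \leq M$ for all $t \in \mathbb{R}$ and some constant $M>0$, and $a_0 \leq a(t) \leq a_1$ for all $t \in \mathbb{R}$ and some constants $a_1 \geq a_0 > 0$. Then the equation $$u''(t) - a(t)\,u(t)^3 = f(t), \qquad t \in \mathbb{R},$$ has a classical solution $u$ that is uniformly bounded for all $t\in\mathbb{R}$, i.e. $|u(t)| \leq K$ for all $t \in \mathbb{R}$ and some $K>0$. Such a solution (a classical solution bounded on all of $\mathbb{R}$) is unique.
   Context: A classical solution is a function $u \in C^2(\mathbb{R})$ (real-valued) satisfying the equation at every $t \in \mathbb{R}$. *)

theory Defs
  imports "HOL-Analysis.Analysis"
begin

definition C2_real :: "(real \<Rightarrow> real) \<Rightarrow> bool" where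
  "C2_real u \<longleftrightarrow>
     u differentiable_on UNIV \<and> deriv u differentiable_on UNIV \<and>
     continuous_on UNIV (deriv (deriv u))"

definition classical_solution ::
  "(real \<Rightarrow> real) \<Rightarrow> (real \<Rightarrow> real) \<Rightarrow> (real \<Rightarrow> real) \<Rightarrow> bool" where
  "classical_solution a f u \<longleftrightarrow>
     C2_real u \<and> (\<forall>t. deriv (deriv u) t - a t * u t ^ 3 = f t)"

end

(* Existence: for k^2 = 3 a1 K^2 with a0 K^3 >= M, rewrite the equation as
   -u'' + k^2 u = h(t, u) with h(t, u) = k^2 u - a(t) u^3 - f(t).  The operator -D^2 + k^2 =
   (k - D)(k + D) has an inverse on bounded continuous functions of norm 1/k^2, obtained by
   solving two first-order equations.  On |u| <= K the function h is nondecreasing in u, and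
   |h(t, u) - h(t, v)| <= k^2 |u - v| - (a0/4) |u - v|^3, so the solution map sends the ball of
   radius K into itself and satisfies d(F u, F v) <= d(u, v) - c d(u, v)^3.  The cubic gain
   replaces strict contractivity and makes the Picard iterates converge.
   Uniqueness: for the difference w of two bounded solutions, w^2 is convex and bounded on the
   real line, hence constant, and (w^2)'' >= (a0/2) w^4 gives w = 0. *)
theory Submission
  imports Defs
begin

section \<open>Fixed points of maps with a cubic gain\<close>

text \<open>Telescoping the gain along the orbit bounds the sum of the cubes of the successive
  distances \<open>d n\<close>, so \<open>d n\<close> tends to 0 although \<open>F\<close> may have
  no Lipschitz constant below 1. The same gain then turns small \<open>d m\<close> and
  \<open>d n\<close> into a small distance between \<open>x m\<close> and
  \<open>x n\<close>.\<close>

lemma fixed_point_cubic_gain: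
  fixes F :: "'a::metric_space \<Rightarrow> 'a"
  assumes S: "complete S" "S \<noteq> {}" and FS: "\<And>x. x \<in> S \<Longrightarrow> F x \<in> S"
    and c: "c > 0"
    and gain: "\<And>x y. x \<in> S \<Longrightarrow> y \<in> S \<Longrightarrow> dist (F x) (F y) \<le> dist x y - c * dist x y ^ 3"
  shows "\<exists>x\<in>S. F x = x"
proof -
  obtain x0 where x0: "x0 \<in> S" using S(2) by blast
  define x where "x n = (F ^^ n) x0" for n
  have xS: "x n \<in> S" for n
    by (induction n) (auto simp: x_def x0 FS)
  have xSuc: "x (Suc n) = F (x n)" for n
    by (simp add: x_def)
  define d where "d n = dist (x n) (x (Suc n))" for n
  have d0: "d n \<ge> 0" for n by (simp add: d_def)
  have step: "c * d n ^ 3 \<le> d n - d (Suc n)" for n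
    using gain[OF xS[of n] xS[of "Suc n"]] by (simp add: d_def xSuc)
  have "(\<Sum>i<n. c * d i ^ 3) \<le> d 0" for n
  proof -
    have "(\<Sum>i<n. c * d i ^ 3) \<le> (\<Sum>i<n. d i - d (Suc i))"
      by (intro sum_mono step)
    also have "\<dots> = d 0 - d n"
      by (rule sum_lessThan_telescope')
    finally show ?thesis using d0[of n] by linarith
  qed
  then have "summable (\<lambda>i. c * d i ^ 3)"
    using c d0 by (intro summableI_nonneg_bounded[where x = "d 0"]) auto
  then have lim3: "(\<lambda>i. c * d i ^ 3) \<longlonglongrightarrow> 0"
    by (rule summable_LIMSEQ_zero)
  have dlim: "d \<longlonglongrightarrow> 0"
  proof (rule LIMSEQ_I)
    fix e :: real assume e: "e > 0"
    with c have "c * e ^ 3 > 0" by simp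
    from LIMSEQ_D[OF lim3 this] obtain N where N: "\<And>n. n \<ge> N \<Longrightarrow> norm (c * d n ^ 3 - 0) < c * e ^ 3"
      by blast
    have "norm (d n - 0) < e" if "n \<ge> N" for n
    proof -
      have "d n ^ 3 < e ^ 3" using N[OF that] c d0[of n] by simp
      then have "d n < e" using e by (meson power_less_imp_less_base less_imp_le)
      then show ?thesis using d0[of n] by simp
    qed
    then show "\<exists>N. \<forall>n\<ge>N. norm (d n - 0) < e" by blast
  qed
  \<comment> \<open>Go from \<open>x m\<close> to \<open>x n\<close> through \<open>F (x m)\<close>
    and \<open>F (x n)\<close>. In the gain for the middle pair, \<open>dist (x m) (x n)\<close>
    cancels and only its cube remains.\<close>
  have key: "c * dist (x m) (x n) ^ 3 \<le> d m + d n" for m n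
  proof -
    have "dist (x m) (x n) \<le> d m + dist (F (x m)) (F (x n)) + d n"
      using dist_triangle[of "x m" "x n" "F (x m)"] dist_triangle2[of "F (x m)" "x n" "F (x n)"]
      by (simp add: d_def xSuc)
    with gain[OF xS[of m] xS[of n]] show ?thesis by linarith
  qed
  have "Cauchy x"
  proof (rule metric_CauchyI)
    fix e :: real assume e: "e > 0"
    with c have "c * e ^ 3 / 2 > 0" by simp
    from LIMSEQ_D[OF dlim this] obtain N where N: "\<And>n. n \<ge> N \<Longrightarrow> norm (d n - 0) < c * e ^ 3 / 2"
      by blast
    have "dist (x m) (x n) < e" if "m \<ge> N" "n \<ge> N" for m n
    proof -
      have "c * dist (x m) (x n) ^ 3 < c * e ^ 3"
        using key[of m n] N[OF that(1)] N[OF that(2)] by simp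
      then show ?thesis using c e
        by (metis mult_less_cancel_left_pos power_less_imp_less_base less_imp_le)
    qed
    then show "\<exists>N. \<forall>m\<ge>N. \<forall>n\<ge>N. dist (x m) (x n) < e" by blast
  qed
  then obtain l where l: "l \<in> S" "x \<longlonglongrightarrow> l"
    using S(1) xS unfolding complete_def by blast
  have lim0: "(\<lambda>n. dist (x n) l) \<longlonglongrightarrow> 0"
    using l(2) by (rule tendsto_dist_iff[THEN iffD1])
  have "dist (x (Suc n)) (F l) \<le> dist (x n) l" for n
  proof -
    have "0 \<le> c * dist (x n) l ^ 3" using c by simp
    with gain[OF xS[of n] l(1)] show ?thesis unfolding xSuc by linarith
  qed
  then have "(\<lambda>n. dist (x (Suc n)) (F l)) \<longlonglongrightarrow> 0"
    by (intro Lim_null_comparison[OF _ lim0] always_eventually allI) simp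
  then have "(\<lambda>n. x (Suc n)) \<longlonglongrightarrow> F l"
    by (rule tendsto_dist_iff[THEN iffD2])
  moreover have "(\<lambda>n. x (Suc n)) \<longlonglongrightarrow> l"
    using l(2) by (rule LIMSEQ_Suc)
  ultimately have "F l = l"
    using LIMSEQ_unique by blast
  then show ?thesis using l(1) by blast
qed

section \<open>Bounded solutions of linear equations\<close>

text \<open>With the integrating factor \<open>exp (k * t)\<close>, the function \<open>E\<close> is
  nonincreasing. Boundedness of \<open>p\<close> gives an upper bound for \<open>E s\<close> that
  tends to 0 as \<open>s\<close> goes to minus infinity, so \<open>E\<close> is never
  positive.\<close>

lemma bounded_solution_le:
  fixes p h :: "real \<Rightarrow> real"
  assumes k: "k > 0" and p: "\<And>t. (p has_real_derivative h t - k * p t) (at t)"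
    and pb: "bounded (range p)" and h: "\<And>t. h t \<le> B"
  shows "p t \<le> B / k"
proof -
  obtain C where C: "\<And>t. \<bar>p t\<bar> \<le> C"
    using pb by (auto simp: bounded_iff)
  define E where "E t = exp (k * t) * (p t - B / k)" for t
  have dE: "(E has_real_derivative exp (k * t) * (h t - B)) (at t)" for t
    unfolding E_def using k
    by (auto intro!: derivative_eq_intros p simp: field_simps)
  have anti: "E t \<le> E s" if "s \<le> t" for s
  proof (rule DERIV_nonpos_imp_nonincreasing[OF that])
    fix x
    have "exp (k * x) * (h x - B) \<le> 0"
      using h[of x] by (simp add: mult_nonneg_nonpos)
    then show "\<exists>y. (E has_real_derivative y) (at x) \<and> y \<le> 0"
      using dE by blast
  qed
  have Es: "E s \<le> exp (k * s) * (C + \<bar>B / k\<bar>)" for s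
    unfolding E_def using C[of s] by (intro mult_left_mono) (auto simp: abs_if split: if_splits)
  have "filterlim (\<lambda>s. k * s) at_bot at_bot"
    using k by (rule filterlim_tendsto_pos_mult_at_bot[OF tendsto_const _ filterlim_ident])
  then have "((\<lambda>s. exp (k * s)) \<longlongrightarrow> 0) at_bot"
    by (rule filterlim_compose[OF exp_at_bot])
  then have lim: "((\<lambda>s. exp (k * s) * (C + \<bar>B / k\<bar>)) \<longlongrightarrow> 0) at_bot"
    by (rule tendsto_mult_left_zero)
  have "E t \<le> 0"
  proof (rule tendsto_lowerbound[OF lim])
    show "\<forall>\<^sub>F s in at_bot. E t \<le> exp (k * s) * (C + \<bar>B / k\<bar>)"
      using eventually_le_at_bot[of t] by eventually_elim (use anti Es order_trans in blast)
  qed simp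
  then show ?thesis
    by (simp add: E_def mult_le_0_iff)
qed

lemma bounded_solution_abs_le:
  fixes p h :: "real \<Rightarrow> real"
  assumes k: "k > 0" and p: "\<And>t. (p has_real_derivative h t - k * p t) (at t)"
    and pb: "bounded (range p)" and h: "\<And>t. \<bar>h t\<bar> \<le> B"
  shows "\<bar>p t\<bar> \<le> B / k"
proof -
  have "p t \<le> B / k"
    using h by (intro bounded_solution_le[where p = p and h = h, OF k p pb]) (auto simp: abs_le_iff)
  moreover have "- p t \<le> B / k"
  proof (rule bounded_solution_le[where p = "\<lambda>t. - p t" and h = "\<lambda>t. - h t", OF k])
    show "((\<lambda>t. - p t) has_real_derivative - h t - k * - p t) (at t)" for t
      using DERIV_minus[OF p[of t]] by simp
    show "bounded (range (\<lambda>t. - p t))"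
      using pb by (auto simp: bounded_iff)
    show "- h t \<le> B" for t
      using h[of t] by (auto simp: abs_le_iff)
  qed
  ultimately show ?thesis by (simp add: abs_le_iff)
qed

text \<open>The solution is \<open>exp (- (k * t))\<close> times the integral of
  \<open>exp (k * s) * h s\<close> from minus infinity to \<open>t\<close>. That improper integral
  is represented as \<open>H t - c\<close>, with \<open>H\<close> an antiderivative and
  \<open>c\<close> its limit at minus infinity.\<close>

lemma bounded_solution_exists:
  fixes h :: "real \<Rightarrow> real"
  assumes k: "k > 0" and ch: "continuous_on UNIV h" and h: "\<And>t. \<bar>h t\<bar> \<le> B"
  shows "\<exists>p. (\<forall>t. (p has_real_derivative h t - k * p t) (at t)) \<and> bounded (range p)"
proof -
  have "isCont (\<lambda>t. exp (k * t) * h t) x" for x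
    using ch by (intro continuous_intros) (simp_all add: continuous_on_eq_continuous_at)
  then obtain H where H: "\<And>t. (H has_real_derivative exp (k * t) * h t) (at t)"
    using einterval_antiderivative[of "-\<infinity>" "\<infinity>" "\<lambda>t. exp (k * t) * h t"]
    by (auto simp: has_real_derivative_iff_has_vector_derivative)
  \<comment> \<open>Adding or subtracting an antiderivative of \<open>B * exp (k * t)\<close>
    encloses \<open>H\<close> between a nondecreasing \<open>U\<close> and a nonincreasing
    \<open>L\<close>, because \<open>h\<close> lies between \<open>- B\<close> and
    \<open>B\<close>.\<close>
  define U where "U t = H t + B / k * exp (k * t)" for t
  define L where "L t = H t - B / k * exp (k * t)" for t
  have dU: "(U has_real_derivative exp (k * t) * (h t + B)) (at t)" for t
    unfolding U_def using k by (auto intro!: derivative_eq_intros H simp: field_simps)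
  have dL: "(L has_real_derivative exp (k * t) * (h t - B)) (at t)" for t
    unfolding L_def using k by (auto intro!: derivative_eq_intros H simp: field_simps)
  have U: "U s \<le> U t" if "s \<le> t" for s t
  proof (rule DERIV_nonneg_imp_nondecreasing[OF that])
    fix x
    have "exp (k * x) * (h x + B) \<ge> 0" using h[of x] by (simp add: abs_le_iff)
    then show "\<exists>y. (U has_real_derivative y) (at x) \<and> 0 \<le> y" using dU by blast
  qed
  have L: "L t \<le> L s" if "s \<le> t" for s t
  proof (rule DERIV_nonpos_imp_nonincreasing[OF that])
    fix x
    have "exp (k * x) * (h x - B) \<le> 0" using h[of x] by (simp add: mult_nonneg_nonpos abs_le_iff)
    then show "\<exists>y. (L has_real_derivative y) (at x) \<and> y \<le> 0" using dL by blast
  qed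
  have B: "B \<ge> 0" using h[of 0] by linarith
  then have "L t \<le> U t" for t
    unfolding L_def U_def using k by (smt (verit) divide_nonneg_pos exp_ge_zero mult_nonneg_nonneg)
  then have LU: "L t \<le> U s" for s t
    using U L by (meson linear order_trans)
  \<comment> \<open>The common value of the limits of U, L and H at minus infinity.\<close>
  define c where "c = Inf (range U)"
  have "c \<le> U t" for t
    unfolding c_def by (intro cInf_lower) (auto intro!: bdd_belowI[of _ "L 0"] LU)
  moreover have "L t \<le> c" for t
    unfolding c_def by (intro cInf_greatest) (auto intro: LU)
  ultimately have Hc: "\<bar>H t - c\<bar> \<le> B / k * exp (k * t)" for t
    unfolding U_def L_def by (smt (verit))
  define p where "p t = exp (- (k * t)) * (H t - c)" for t
  have "(p has_real_derivative h t - k * p t) (at t)" for t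
    unfolding p_def
    by (auto intro!: derivative_eq_intros H simp: algebra_simps simp flip: exp_add)
  moreover have "\<bar>p t\<bar> \<le> B / k" for t
  proof -
    have "\<bar>p t\<bar> = exp (- (k * t)) * \<bar>H t - c\<bar>"
      by (simp add: p_def abs_mult)
    also have "\<dots> \<le> exp (- (k * t)) * (B / k * exp (k * t))"
      by (intro mult_left_mono Hc) simp
    also have "\<dots> = B / k"
      by (simp add: exp_minus)
    finally show ?thesis .
  qed
  ultimately show ?thesis by (auto simp: bounded_iff)
qed

section \<open>The backward equation q' = k q - h, reduced to the forward one by time
  reversal\<close>

lemma DERIV_reflect:
  fixes q :: "real \<Rightarrow> real"
  assumes "(q has_real_derivative D) (at (- t))"
  shows "((\<lambda>t. q (- t)) has_real_derivative - D) (at t)"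
  using DERIV_chain2[where f = q and g = uminus, OF assms DERIV_minus[OF DERIV_ident]] by simp

lemma bounded_range_reflect: "bounded (range q) \<Longrightarrow> bounded (range (\<lambda>t::real. q (- t)))"
  by (erule bounded_subset) auto

lemma backward_bounded_solution_exists:
  fixes h :: "real \<Rightarrow> real"
  assumes k: "k > 0" and ch: "continuous_on UNIV h" and h: "\<And>t. \<bar>h t\<bar> \<le> B"
  shows "\<exists>q. (\<forall>t. (q has_real_derivative k * q t - h t) (at t)) \<and> bounded (range q)"
proof -
  have "continuous_on UNIV (\<lambda>t. h (- t))"
    by (intro continuous_on_compose2[OF ch] continuous_intros) auto
  from bounded_solution_exists[where h = "\<lambda>t. h (- t)", OF k this h] obtain p
    where p: "\<And>t. (p has_real_derivative h (- t) - k * p t) (at t)" "bounded (range p)" by blast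
  have "((\<lambda>t. p (- t)) has_real_derivative k * p (- t) - h t) (at t)" for t
    using DERIV_reflect[OF p(1)[of "- t"]] by simp
  then show ?thesis using bounded_range_reflect[OF p(2)] by blast
qed

lemma backward_bounded_solution_abs_le:
  fixes q h :: "real \<Rightarrow> real"
  assumes k: "k > 0" and q: "\<And>t. (q has_real_derivative k * q t - h t) (at t)"
    and qb: "bounded (range q)" and h: "\<And>t. \<bar>h t\<bar> \<le> B"
  shows "\<bar>q t\<bar> \<le> B / k"
proof -
  have "\<bar>q (- (- t))\<bar> \<le> B / k"
  proof (rule bounded_solution_abs_le[where p = "\<lambda>t. q (- t)" and h = "\<lambda>t. h (- t)",
        OF k _ bounded_range_reflect[OF qb]])
    show "((\<lambda>t. q (- t)) has_real_derivative h (- t) - k * q (- t)) (at t)" for t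
      using DERIV_reflect[OF q[of "- t"]] by simp
  qed (rule h)
  then show ?thesis by simp
qed

text \<open>Says that y is the bounded solution of - y'' + k^2 y = h, with z = y' + k y.\<close>

definition bounded_resolvent :: "real \<Rightarrow> (real \<Rightarrow> real) \<Rightarrow> (real \<Rightarrow> real) \<Rightarrow> bool" where
  "bounded_resolvent k h y \<longleftrightarrow> bounded (range y) \<and>
     (\<exists>z. bounded (range z) \<and> (\<forall>t. (z has_real_derivative k * z t - h t) (at t)) \<and>
          (\<forall>t. (y has_real_derivative z t - k * y t) (at t)))"

text \<open>The factor k - D is inverted first. The resulting \<open>z\<close> is continuous and
  bounded by \<open>B / k\<close>, so it can serve as right-hand side when k + D is
  inverted.\<close>

lemma bounded_resolvent_exists:
  assumes k: "k > 0" and ch: "continuous_on UNIV h" and h: "\<And>t. \<bar>h t\<bar> \<le> B"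
  shows "\<exists>y. bounded_resolvent k h y"
proof -
  obtain z where z: "\<And>t. (z has_real_derivative k * z t - h t) (at t)" "bounded (range z)"
    using backward_bounded_solution_exists[OF assms] by blast
  have zB: "\<bar>z t\<bar> \<le> B / k" for t
    by (rule backward_bounded_solution_abs_le[where q = z and h = h, OF k z h])
  have cz: "continuous_on UNIV z"
    by (rule DERIV_continuous_on[OF z(1)])
  obtain y where "\<And>t. (y has_real_derivative z t - k * y t) (at t)" "bounded (range y)"
    using bounded_solution_exists[OF k cz zB] by blast
  then show ?thesis using z unfolding bounded_resolvent_def by blast
qed

text \<open>Each first-order inversion costs a factor \<open>1 / k\<close>. The estimate covers
  every \<open>y\<close> in the relation, hence also differences of two solutions.\<close>

lemma bounded_resolvent_abs_le:
  assumes k: "k > 0" and y: "bounded_resolvent k h y" and h: "\<And>t. \<bar>h t\<bar> \<le> B"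
  shows "\<bar>y t\<bar> \<le> B / k\<^sup>2"
proof -
  obtain z where z: "\<And>t. (z has_real_derivative k * z t - h t) (at t)" "bounded (range z)"
      and y': "\<And>t. (y has_real_derivative z t - k * y t) (at t)" "bounded (range y)"
    using y unfolding bounded_resolvent_def by blast
  have zB: "\<bar>z t\<bar> \<le> B / k" for t
    by (rule backward_bounded_solution_abs_le[where q = z and h = h, OF k z h])
  have "\<bar>y t\<bar> \<le> B / k / k"
    by (rule bounded_solution_abs_le[where p = y and h = z, OF k y' zB])
  then show ?thesis by (simp add: power2_eq_square)
qed

text \<open>Linearity is what turns the norm bound into an estimate for the distance of two images
  under the solution map.\<close>

lemma bounded_resolvent_diff:
  assumes "bounded_resolvent k g x" "bounded_resolvent k h y"
  shows "bounded_resolvent k (\<lambda>t. g t - h t) (\<lambda>t. x t - y t)"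
proof -
  obtain z where z: "\<And>t. (z has_real_derivative k * z t - g t) (at t)" "bounded (range z)"
      "\<And>t. (x has_real_derivative z t - k * x t) (at t)" "bounded (range x)"
    using assms(1) unfolding bounded_resolvent_def by blast
  obtain w where w: "\<And>t. (w has_real_derivative k * w t - h t) (at t)" "bounded (range w)"
      "\<And>t. (y has_real_derivative w t - k * y t) (at t)" "bounded (range y)"
    using assms(2) unfolding bounded_resolvent_def by blast
  show ?thesis
    unfolding bounded_resolvent_def
  proof (intro conjI exI[of _ "\<lambda>t. z t - w t"] allI)
    show "((\<lambda>t. z t - w t) has_real_derivative k * (z t - w t) - (g t - h t)) (at t)" for t
      by (auto intro!: derivative_eq_intros z w simp: algebra_simps)
    show "((\<lambda>t. x t - y t) has_real_derivative z t - w t - k * (x t - y t)) (at t)" for t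
      by (auto intro!: derivative_eq_intros z w simp: algebra_simps)
  qed (auto intro!: bounded_minus_comp z w)
qed

lemma bounded_resolvent_second_derivative:
  assumes "bounded_resolvent k h y"
  obtains y' where "\<And>t. (y has_real_derivative y' t) (at t)"
    "\<And>t. (y' has_real_derivative k\<^sup>2 * y t - h t) (at t)"
proof -
  obtain z where z: "\<And>t. (z has_real_derivative k * z t - h t) (at t)"
      "\<And>t. (y has_real_derivative z t - k * y t) (at t)"
    using assms unfolding bounded_resolvent_def by blast
  have "((\<lambda>t. z t - k * y t) has_real_derivative k\<^sup>2 * y t - h t) (at t)" for t
    by (auto intro!: derivative_eq_intros z simp: algebra_simps power2_eq_square)
  with z(2) show ?thesis by (rule that)
qed

lemma bounded_resolvent_in_bcontfun:
  assumes "bounded_resolvent k h y"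
  shows "y \<in> bcontfun"
  using assms unfolding bounded_resolvent_def bcontfun_def by (auto intro: DERIV_continuous_on)

section \<open>The cubic nonlinearity\<close>

text \<open>In the factorization of the difference of cubes, the quadratic factor is at most
  \<open>3 * R\<^sup>2\<close>. The lemma serves both for the values of the unknown (radius K) and
  for distances between two of them (radius 2K).\<close>

lemma linear_minus_cubic_mono:
  fixes x y c \<mu> R :: real
  assumes "c \<ge> 0" "3 * c * R\<^sup>2 \<le> \<mu>" "\<bar>x\<bar> \<le> R" "\<bar>y\<bar> \<le> R" "x \<le> y"
  shows "\<mu> * x - c * x ^ 3 \<le> \<mu> * y - c * y ^ 3"
proof -
  have sq: "x\<^sup>2 \<le> R\<^sup>2" "y\<^sup>2 \<le> R\<^sup>2"
    using assms(3,4) by (metis abs_ge_zero power2_abs power_mono)+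
  have "2 * (x * y) \<le> x\<^sup>2 + y\<^sup>2"
    using sum_squares_bound[of x y] by simp
  then have "y\<^sup>2 + y * x + x\<^sup>2 \<le> 3 * R\<^sup>2" using sq by (simp add: mult.commute)
  then have "c * (y\<^sup>2 + y * x + x\<^sup>2) \<le> \<mu>"
    using mult_left_mono[OF _ assms(1)] assms(2) by fastforce
  then have "0 \<le> (y - x) * (\<mu> - c * (y\<^sup>2 + y * x + x\<^sup>2))"
    using assms(5) by simp
  also have "\<dots> = \<mu> * y - c * y ^ 3 - (\<mu> * x - c * x ^ 3)"
    by (simp add: algebra_simps power2_eq_square power3_eq_cube)
  finally show ?thesis by simp
qed

text \<open>The defect is exactly \<open>3 / 4 * (y - x) * (x + y)\<^sup>2\<close>; the constant 1/4
  is attained at y = -x.\<close>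

lemma diff_cubes_lower_bound:
  fixes x y :: real
  assumes "x \<le> y"
  shows "(y - x) ^ 3 / 4 \<le> y ^ 3 - x ^ 3"
proof -
  have "0 \<le> (y - x) * (3 / 4 * (x + y)\<^sup>2)" using assms by simp
  also have "\<dots> = y ^ 3 - x ^ 3 - (y - x) ^ 3 / 4"
    by (simp add: field_simps power2_eq_square power3_eq_cube)
  finally show ?thesis by simp
qed

text \<open>For ordered arguments the bound on cubes gives the estimate with \<open>y - x\<close> in
  place of \<open>D\<close>. Its right-hand side is nondecreasing in the gap up to
  \<open>2 * K\<close>, so the gap may be enlarged to \<open>D\<close>, later the sup distance of
  two functions.\<close>

lemma linear_minus_cubic_gain:
  fixes x y \<alpha> a0 \<mu> K D :: real
  assumes "0 \<le> a0" "a0 \<le> \<alpha>" "3 * \<alpha> * K\<^sup>2 \<le> \<mu>" "\<bar>x\<bar> \<le> K" "\<bar>y\<bar> \<le> K"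
    and D: "\<bar>x - y\<bar> \<le> D" "D \<le> 2 * K"
  shows "\<bar>(\<mu> * x - \<alpha> * x ^ 3) - (\<mu> * y - \<alpha> * y ^ 3)\<bar> \<le> \<mu> * D - a0 / 4 * D ^ 3"
  using assms(4,5) D(1)
proof (induction x y rule: linorder_wlog)
  case (le x y)
  have "(\<mu> * y - \<alpha> * y ^ 3) - (\<mu> * x - \<alpha> * x ^ 3) = \<mu> * (y - x) - \<alpha> * (y ^ 3 - x ^ 3)"
    by (simp add: algebra_simps)
  also have "\<dots> \<le> \<mu> * (y - x) - a0 * ((y - x) ^ 3 / 4)"
    using mult_mono[OF assms(2) diff_cubes_lower_bound[OF le(1)]] assms(1,2) le(1) by simp
  also have "\<dots> = \<mu> * (y - x) - a0 / 4 * (y - x) ^ 3" by simp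
  also have "\<dots> \<le> \<mu> * D - a0 / 4 * D ^ 3"
  proof (rule linear_minus_cubic_mono[where R = "2 * K"])
    have "a0 * K\<^sup>2 \<le> \<alpha> * K\<^sup>2" by (rule mult_right_mono[OF assms(2)]) simp
    \<comment> \<open>The 4 from squaring the radius \<open>2 * K\<close> cancels the 1/4 of the
      gain, so the condition is again of the form 3 a0 K^2 at most \<open>\<mu>\<close>.\<close>
    then show "3 * (a0 / 4) * (2 * K)\<^sup>2 \<le> \<mu>" using assms(3) by (simp add: power_mult_distrib)
  qed (use assms le in auto)
  \<comment> \<open>Monotonicity on [-K, K] makes the difference nonnegative, so its upper bound
    also bounds the absolute value.\<close>
  finally show ?case
    using linear_minus_cubic_mono[OF _ assms(3) le(2,3,1)] assms(1,2) by simp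
next
  case (sym x y)
  then show ?case by (simp add: abs_minus_commute)
qed

text \<open>By monotonicity the extreme values occur at K and -K, where the cubic term leaves a
  margin \<open>\<alpha> * K ^ 3\<close> that absorbs \<open>b\<close>. This keeps the ball of
  radius K invariant.\<close>

lemma linear_minus_cubic_bound:
  fixes x \<alpha> b \<mu> K :: real
  assumes "0 \<le> \<alpha>" "3 * \<alpha> * K\<^sup>2 \<le> \<mu>" "\<bar>x\<bar> \<le> K" "\<bar>b\<bar> \<le> \<alpha> * K ^ 3"
  shows "\<bar>\<mu> * x - \<alpha> * x ^ 3 - b\<bar> \<le> \<mu> * K"
proof -
  have "\<mu> * x - \<alpha> * x ^ 3 \<le> \<mu> * K - \<alpha> * K ^ 3"
    by (rule linear_minus_cubic_mono[OF assms(1,2)]) (use assms(3) in auto)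
  moreover have "\<mu> * (- K) - \<alpha> * (- K) ^ 3 \<le> \<mu> * x - \<alpha> * x ^ 3"
    by (rule linear_minus_cubic_mono[OF assms(1,2)]) (use assms(3) in auto)
  ultimately show ?thesis using assms(4) by (simp add: abs_le_iff)
qed

section \<open>Existence and uniqueness\<close>

lemma cubic_equation_bounded_solution:
  fixes a f :: "real \<Rightarrow> real" and M a0 a1 :: real
  assumes ca: "continuous_on UNIV a" and cf: "continuous_on UNIV f"
    and f: "\<And>t. \<bar>f t\<bar> \<le> M" and a0: "a0 > 0" and a: "\<And>t. a0 \<le> a t" "\<And>t. a t \<le> a1"
  obtains u u' K where "\<And>t. (u has_real_derivative u' t) (at t)"
    "\<And>t. (u' has_real_derivative a t * u t ^ 3 + f t) (at t)"
    "K > 0" "\<And>t. \<bar>u t\<bar> \<le> K"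
proof -
  \<comment> \<open>Since K is at least 1, K^3 dominates K, so \<open>M / a0\<close> suffices for
    \<open>M \<le> a0 * K ^ 3\<close> and no cube root is taken.\<close>
  define K where "K = max 1 (M / a0)"
  have K: "K \<ge> 1" "M \<le> a0 * K" using a0 by (auto simp: K_def field_simps max_def)
  have "a0 * K \<le> a0 * K ^ 3" using K(1) a0 by (simp add: self_le_power)
  moreover have "a0 * K ^ 3 \<le> a t * K ^ 3" for t
    using K(1) by (intro mult_right_mono a(1)) simp
  ultimately have M: "M \<le> a t * K ^ 3" for t
    using K(2) by (meson order_trans)
  have a1: "a1 > 0" using a0 a[of 0] by linarith
  \<comment> \<open>Chosen so that \<open>k\<^sup>2\<close> dominates
    \<open>3 * a t * K\<^sup>2\<close> for all t, which makes \<open>h\<close> nondecreasing in the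
    unknown on [-K, K].\<close>
  define k where "k = sqrt (3 * a1 * K\<^sup>2)"
  have k: "k > 0" and k2: "k\<^sup>2 = 3 * a1 * K\<^sup>2" using a1 K by (auto simp: k_def)
  have ak: "3 * a t * K\<^sup>2 \<le> k\<^sup>2" for t
    unfolding k2 using a(2)[of t] by (simp add: mult_right_mono)
  have at: "0 \<le> a t" for t using a0 a(1)[of t] by linarith
  define h where "h u t = k\<^sup>2 * u t - a t * u t ^ 3 - f t" for u t
  \<comment> \<open>The closed sup-norm ball of radius K, encoded by \<open>PiC\<close> so that
    completeness comes from \<open>closed_PiC\<close>.\<close>
  define S :: "(real \<Rightarrow>\<^sub>C real) set" where "S = PiC UNIV (\<lambda>_. cball 0 K)"
  have S: "u \<in> S \<longleftrightarrow> (\<forall>t. \<bar>u t\<bar> \<le> K)" for u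
    by (auto simp: S_def mem_PiC_iff Pi_iff)
  have complete: "complete S"
    unfolding S_def complete_eq_closed by (intro closed_PiC) auto
  have "const_bcontfun 0 \<in> S"
    unfolding S using K by (simp add: const_bcontfun.rep_eq)
  then have nonempty: "S \<noteq> {}" by blast
  have hb: "\<bar>h u t\<bar> \<le> k\<^sup>2 * K" if "u \<in> S" for u t
    unfolding h_def using that S f[of t] M[of t]
    by (intro linear_minus_cubic_bound at ak) auto
  have "\<exists>v\<in>S. bounded_resolvent k (h u) v" if u: "u \<in> S" for u
  proof -
    have "continuous_on UNIV (h u)"
      unfolding h_def by (intro continuous_intros ca cf) auto
    from bounded_resolvent_exists[OF k this hb[OF u]] obtain y
      where y: "bounded_resolvent k (h u) y" by blast
    obtain v where v: "y = apply_bcontfun v"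
      using bounded_resolvent_in_bcontfun[OF y] by (rule bcontfunE)
    have "\<bar>v t\<bar> \<le> K" for t
      using bounded_resolvent_abs_le[OF k y hb[OF u], of t] k by (simp add: v)
    then show ?thesis using y S v by blast
  qed
  then obtain F where FS: "\<And>u. u \<in> S \<Longrightarrow> F u \<in> S"
      and F: "\<And>u. u \<in> S \<Longrightarrow> bounded_resolvent k (h u) (F u)"
    by metis
  \<comment> \<open>The gain \<open>a0 / 4\<close> of the nonlinearity, scaled by the resolvent
    bound \<open>1 / k\<^sup>2\<close>.\<close>
  define c where "c = a0 / (4 * k\<^sup>2)"
  have c: "c > 0" using a0 k by (simp add: c_def)
  have gain: "dist (F u) (F v) \<le> dist u v - c * dist u v ^ 3" if u: "u \<in> S" and v: "v \<in> S" for u v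
  proof (rule dist_bound)
    fix t
    let ?D = "dist u v"
    have uv: "\<bar>u s\<bar> \<le> K" "\<bar>v s\<bar> \<le> K" for s
      using u v by (simp_all add: S)
    have D: "?D \<le> 2 * K"
    proof (rule dist_bound)
      show "dist (u s) (v s) \<le> 2 * K" for s
        using uv[of s] by (simp add: dist_real_def abs_le_iff)
    qed
    \<comment> \<open>The right-hand side contains the sup distance and not the distance at
      \<open>s\<close>. It is thus independent of \<open>s\<close> and can be the bound
      \<open>B\<close> of the resolvent estimate.\<close>
    have hD: "\<bar>h u s - h v s\<bar> \<le> k\<^sup>2 * ?D - a0 / 4 * ?D ^ 3" for s
    proof -
      have "\<bar>u s - v s\<bar> \<le> ?D" using dist_bounded[of u s v] by (simp add: dist_real_def)
      then have "\<bar>(k\<^sup>2 * u s - a s * u s ^ 3) - (k\<^sup>2 * v s - a s * v s ^ 3)\<bar>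
          \<le> k\<^sup>2 * ?D - a0 / 4 * ?D ^ 3"
        using a0 D uv by (intro linear_minus_cubic_gain[OF _ a(1) ak]) auto
      then show ?thesis by (simp add: h_def)
    qed
    have "\<bar>F u t - F v t\<bar> \<le> (k\<^sup>2 * ?D - a0 / 4 * ?D ^ 3) / k\<^sup>2"
      using bounded_resolvent_abs_le[OF k bounded_resolvent_diff[OF F[OF u] F[OF v]]] hD by blast
    also have "\<dots> = ?D - c * ?D ^ 3" using k by (simp add: c_def field_simps)
    finally show "dist (F u t) (F v t) \<le> ?D - c * ?D ^ 3" by (simp add: dist_real_def)
  qed
  obtain u where u: "u \<in> S" "F u = u"
    using fixed_point_cubic_gain[OF complete nonempty FS c gain] by blast
  obtain u' where u': "\<And>t. (apply_bcontfun u has_real_derivative u' t) (at t)"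
      "\<And>t. (u' has_real_derivative k\<^sup>2 * u t - h u t) (at t)"
    using bounded_resolvent_second_derivative[OF F[OF u(1)]] u(2) by auto
  have "(u' has_real_derivative a t * u t ^ 3 + f t) (at t)" for t
    using u'(2)[of t] by (simp add: h_def)
  moreover have "\<bar>u t\<bar> \<le> K" for t
    using u(1) by (simp add: S)
  ultimately show ?thesis
    using that[OF u'(1), of K] K(1) by simp
qed

text \<open>A convex function lies above its tangents, and a tangent of nonzero slope is unbounded
  above on the line. So all slopes of a bounded convex function vanish.\<close>

lemma bounded_convex_second_derivative_zero:
  fixes W :: "real \<Rightarrow> real"
  assumes W: "\<And>t. (W has_real_derivative W' t) (at t)"
    and W': "\<And>t. (W' has_real_derivative W'' t) (at t)"
    and nonneg: "\<And>t. W'' t \<ge> 0" and B: "\<And>t. \<bar>W t\<bar> \<le> B"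
  shows "W'' t = 0"
proof -
  have "convex_on UNIV W"
    using assms by (intro f''_ge0_imp_convex[where f' = W' and f'' = W'']) auto
  then have tangent: "W' s * (t - s) \<le> W t - W s" for s t
    by (rule convex_on_imp_above_tangent) (auto simp: W)
  have "W' s = 0" for s
  proof (rule ccontr)
    assume "W' s \<noteq> 0"
    \<comment> \<open>At this point the tangent has risen by \<open>2 * B + 1\<close>, more than the
      largest possible oscillation \<open>2 * B\<close> of \<open>W\<close>.\<close>
    with tangent[of s "s + (2 * B + 1) / W' s"]
    have "2 * B + 1 \<le> W (s + (2 * B + 1) / W' s) - W s" by simp
    then show False
      using B[of s] B[of "s + (2 * B + 1) / W' s"] by linarith
  qed
  then have "W' = (\<lambda>_. 0)" by blast
  then show ?thesis
    using W'[of t] DERIV_unique[OF _ DERIV_const] by blast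
qed

lemma cubic_equation_bounded_unique:
  fixes a f :: "real \<Rightarrow> real"
  assumes a: "\<And>t. a t > 0"
    and u: "\<And>t. (u has_real_derivative u' t) (at t)"
      "\<And>t. (u' has_real_derivative a t * u t ^ 3 + f t) (at t)" "\<And>t. \<bar>u t\<bar> \<le> K"
    and v: "\<And>t. (v has_real_derivative v' t) (at t)"
      "\<And>t. (v' has_real_derivative a t * v t ^ 3 + f t) (at t)" "\<And>t. \<bar>v t\<bar> \<le> L"
  shows "u = v"
proof
  fix t
  \<comment> \<open>The second derivative of (u - v)^2 with both equations inserted;
    \<open>f\<close> cancels.\<close>
  define W'' where "W'' t = 2 * (u' t - v' t)\<^sup>2 + 2 * a t * ((u t - v t) * (u t ^ 3 - v t ^ 3))" for t
  \<comment> \<open>Makes the sign of \<open>W''\<close> visible and isolates a quartic term in the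
    difference.\<close>
  have id: "(x - y) * (x ^ 3 - y ^ 3) = (x - y)\<^sup>2 * (3 / 4 * (x + y)\<^sup>2 + (x - y)\<^sup>2 / 4)" for x y :: real
    by (simp add: field_simps power2_eq_square power3_eq_cube)
  have nonneg: "W'' t \<ge> 0" for t
    unfolding W''_def id using a[of t] by simp
  have "W'' t = 0"
  proof (rule bounded_convex_second_derivative_zero[OF _ _ nonneg])
    show "((\<lambda>t. (u t - v t)\<^sup>2) has_real_derivative 2 * (u t - v t) * (u' t - v' t)) (at t)" for t
      by (auto intro!: derivative_eq_intros u v)
    show "((\<lambda>t. 2 * (u t - v t) * (u' t - v' t)) has_real_derivative W'' t) (at t)" for t
      unfolding W''_def
      by (auto intro!: derivative_eq_intros u v simp: algebra_simps power2_eq_square)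
    show "\<bar>(u t - v t)\<^sup>2\<bar> \<le> (K + L)\<^sup>2" for t
      using u(3)[of t] v(3)[of t] by (simp add: abs_le_square_iff[symmetric])
  qed
  moreover have "2 * a t * ((u t - v t)\<^sup>2 * (3 / 4 * (u t + v t)\<^sup>2 + (u t - v t)\<^sup>2 / 4)) \<le> W'' t"
    unfolding W''_def id by simp
  \<comment> \<open>Dropping the (u + v)^2 term leaves half of \<open>a t * (u t - v t) ^ 4\<close>
    as a lower bound for \<open>W'' t\<close>, which is 0.\<close>
  moreover have "2 * a t * ((u t - v t)\<^sup>2 * ((u t - v t)\<^sup>2 / 4))
      \<le> 2 * a t * ((u t - v t)\<^sup>2 * (3 / 4 * (u t + v t)\<^sup>2 + (u t - v t)\<^sup>2 / 4))"
    using a[of t] by (intro mult_left_mono) auto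
  ultimately have "a t * (u t - v t) ^ 4 \<le> 0"
    by (simp add: power2_eq_square power4_eq_xxxx)
  then have "(u t - v t) ^ 4 \<le> 0"
    using a[of t] by (simp add: mult_le_0_iff)
  then show "u t = v t"
    by (simp add: power_le_zero_eq)
qed

section \<open>Translation between first-order derivative facts and classical solutions\<close>

lemma classical_solutionI:
  assumes u: "\<And>t. (u has_real_derivative u' t) (at t)"
    and u': "\<And>t. (u' has_real_derivative a t * u t ^ 3 + f t) (at t)"
    and ca: "continuous_on UNIV a" and cf: "continuous_on UNIV f"
  shows "classical_solution a f u"
proof -
  have d1: "deriv u = u'" using u by (auto intro!: DERIV_imp_deriv)
  have d2: "deriv u' = (\<lambda>t. a t * u t ^ 3 + f t)" using u' by (auto intro!: DERIV_imp_deriv)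
  have "u differentiable_on UNIV" "u' differentiable_on UNIV"
    using u u' by (auto simp: differentiable_on_def real_differentiable_def)
  \<comment> \<open>The second derivative equals a u^3 + f, so its continuity follows from that of
    \<open>u\<close>, \<open>a\<close> and \<open>f\<close>.\<close>
  moreover have "continuous_on UNIV u" using u by (auto intro: DERIV_continuous_on)
  ultimately show ?thesis
    unfolding classical_solution_def C2_real_def d1 d2
    by (simp add: ca cf continuous_on_add continuous_on_mult continuous_on_power)
qed

lemma classical_solutionD:
  assumes "classical_solution a f u"
  shows "(u has_real_derivative deriv u t) (at t)"
    and "(deriv u has_real_derivative a t * u t ^ 3 + f t) (at t)"
proof -
  have "u differentiable at t" "deriv u differentiable at t"
    using assms by (auto simp: classical_solution_def C2_real_def differentiable_on_def)
  then have "(u has_real_derivative deriv u t) (at t)"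
      "(deriv u has_real_derivative deriv (deriv u) t) (at t)"
    by (auto simp: DERIV_deriv_iff_real_differentiable)
  moreover have "deriv (deriv u) t = a t * u t ^ 3 + f t"
    using assms unfolding classical_solution_def by (metis diff_add_cancel add.commute)
  ultimately show "(u has_real_derivative deriv u t) (at t)"
    and "(deriv u has_real_derivative a t * u t ^ 3 + f t) (at t)" by simp_all
qed

theorem theorem2p1:
  fixes a f :: "real \<Rightarrow> real" and M a0 a1 :: real
  assumes "continuous_on UNIV a" and "continuous_on UNIV f"
    and "M > 0" and "\<And>t. \<bar>f t\<bar> \<le> M"
    and "a0 > 0" and "a1 \<ge> a0" and "\<And>t. a0 \<le> a t \<and> a t \<le> a1"
  shows "\<exists>!u. classical_solution a f u \<and> (\<exists>K>0. \<forall>t. \<bar>u t\<bar> \<le> K)"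
proof (rule ex_ex1I)
  have bounds: "a0 \<le> a t" "a t \<le> a1" for t using assms(7) by auto
  obtain u u' K where "\<And>t. (u has_real_derivative u' t) (at t)"
    "\<And>t. (u' has_real_derivative a t * u t ^ 3 + f t) (at t)" "K > 0" "\<And>t. \<bar>u t\<bar> \<le> K"
    using cubic_equation_bounded_solution[OF assms(1,2,4,5) bounds] by blast
  then show "\<exists>u. classical_solution a f u \<and> (\<exists>K>0. \<forall>t. \<bar>u t\<bar> \<le> K)"
    using classical_solutionI[OF _ _ assms(1,2)] by blast
next
  fix u v
  assume u: "classical_solution a f u \<and> (\<exists>K>0. \<forall>t. \<bar>u t\<bar> \<le> K)"
    and v: "classical_solution a f v \<and> (\<exists>K>0. \<forall>t. \<bar>v t\<bar> \<le> K)"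
  obtain K L where KL: "\<And>t. \<bar>u t\<bar> \<le> K" "\<And>t. \<bar>v t\<bar> \<le> L" using u v by blast
  have pos: "a t > 0" for t using assms(5) assms(7)[of t] by linarith
  show "u = v"
    by (rule cubic_equation_bounded_unique[OF pos
          classical_solutionD[OF conjunct1[OF u]] KL(1)
          classical_solutionD[OF conjunct1[OF v]] KL(2)])
qed

end
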